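(* Let $\sigma>1$ and let $(d_n)_{n\in\mathbb N_0}$ be a strictly increasing divergent sequence of integers with $d_0=0$, for which there exists $L>1$ with $\dfrac{d_{n+1}}{d_n}\le L$ for all $n\in\mathbb N=\{1,2,\dots\}$. Then, for every $\tau>0$, there exist $\tau_1,C_1>0$ such that $$T_{\tau,\sigma,(d_n)}(x)\le T_{\tau,\sigma}(x)\le T_{\tau_1,\sigma,(d_n)}(x)+C_1,\qquad x\ge0,$$ where the constant $C_1$ depends on $\sigma$, $\tau$ and $L$.
   Context: $\mathbb N_0=\{0,1,2,\dots\}$. For $\tau>0$, $\sigma>1$ put $M_0^{\tau,\sigma}=1$ and $M_n^{\tau,\sigma}=n^{\tau n^\sigma}$ for integers $n\ge1$. The associated function of the sequence $(M_n^{\tau,\sigma})_{n\in\mathbb N_0}$ is $$T_{\tau,\sigma}(x)=\sup_{n\in\mathbb N_0}\ln\frac{x^n}{M_n^{\tau,\sigma}},\qquad x\ge0,$$ and, for a sequence $(d_n)_{n\in\mathbb N_0}$ with $d_0=0$ and $\lim_{n\to\infty}d_n=\infty$, $$T_{\tau,\sigma,(d_n)}(x)=\sup_{n\in\mathbb N_0}\ln\frac{x^{d_n}}{M_{d_n}^{\tau,\sigma}},\qquad x\ge0,$$ with the convention $0^0=1$; both functions vanish on $[0,1]$. *)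

theory Defs
  imports Complex_Main
begin

definition Mseq :: "real \<Rightarrow> real \<Rightarrow> nat \<Rightarrow> real" where
  "Mseq \<tau> \<sigma> n = (if n = 0 then 1 else real n powr (\<tau> * real n powr \<sigma>))"

text \<open>
  The suprema below are taken in the reals. For \<open>\<tau> > 0\<close> and \<open>\<sigma> > 1\<close> the sets are bounded above
  (lemmas \<open>bdd_above_assoc_fun\<close> and \<open>bdd_above_assoc_fun_sub\<close>), so \<open>Sup\<close> is the true supremum. For \<open>x = 0\<close>,
  HOL sets \<open>ln 0 = 0\<close> where the usual convention is minus infinity; since \<open>0 ^ 0 = 1\<close>, the
  term with exponent 0 already contributes \<open>0\<close>, so the supremum is \<open>0\<close> under either convention.
\<close>

definition assoc_fun :: "real \<Rightarrow> real \<Rightarrow> real \<Rightarrow> real" where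
  "assoc_fun \<tau> \<sigma> x = (SUP n. ln (x ^ n / Mseq \<tau> \<sigma> n))"

definition assoc_fun_sub :: "real \<Rightarrow> real \<Rightarrow> (nat \<Rightarrow> nat) \<Rightarrow> real \<Rightarrow> real" where
  "assoc_fun_sub \<tau> \<sigma> d x = (SUP n. ln (x ^ d n / Mseq \<tau> \<sigma> (d n)))"

lemma Mseq_ge_1: "\<tau> > 0 \<Longrightarrow> Mseq \<tau> \<sigma> n \<ge> 1"
  by (auto simp: Mseq_def intro!: ge_one_powr_ge_zero)

lemma ln_term_nonpos:
  assumes "\<tau> > 0" "0 \<le> x" "x \<le> 1"
  shows "ln (x ^ n / Mseq \<tau> \<sigma> n) \<le> 0"
proof (cases "x ^ n = 0")
  case False
  have "x ^ n \<le> 1" using assms by (simp add: power_le_one)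
  then have "x ^ n / Mseq \<tau> \<sigma> n \<le> 1" using Mseq_ge_1[OF assms(1), of \<sigma> n] by (simp add: divide_le_eq)
  moreover have "x ^ n / Mseq \<tau> \<sigma> n > 0"
    using False assms(2) Mseq_ge_1[OF assms(1), of \<sigma> n] by (intro divide_pos_pos) auto
  ultimately show ?thesis by simp
qed (use assms in \<open>auto simp: power_0_left\<close>)

lemma bdd_above_assoc_fun:
  assumes "\<tau> > 0" "\<sigma> > 1" "x \<ge> 0"
  shows "bdd_above (range (\<lambda>n. ln (x ^ n / Mseq \<tau> \<sigma> n)))"
proof (cases "x \<le> 1")
  case True
  then show ?thesis using ln_term_nonpos[of \<tau> x] assms by (intro bdd_aboveI[of _ 0]) auto
next
  case False
  define K where "K = (ln x / (\<tau> * ln 2)) powr (1 / (\<sigma> - 1))"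
  have lx: "ln x > 0" and x: "x > 0" using False by auto
  have "ln (x ^ n / Mseq \<tau> \<sigma> n) \<le> max 1 K * ln x" for n
  proof (cases "real n \<le> max 1 K")
    case True
    have "ln (x ^ n / Mseq \<tau> \<sigma> n) \<le> ln (x ^ n)"
      using Mseq_ge_1[OF assms(1), of \<sigma> n] x
      by (intro ln_mono) (auto simp: divide_le_eq)
    also have "\<dots> = n * ln x" using x by (simp add: ln_realpow)
    also have "\<dots> \<le> max 1 K * ln x" using True lx by (intro mult_right_mono) auto
    finally show ?thesis .
  next
    case False
    then have n: "n \<ge> 2" and nK: "real n > K" by auto
    have "ln x / (\<tau> * ln 2) = K powr (\<sigma> - 1)"
      using assms lx by (simp add: K_def powr_powr)
    also have "\<dots> \<le> real n powr (\<sigma> - 1)"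
      using nK assms by (intro powr_mono2) (auto simp: K_def)
    finally have "ln x \<le> \<tau> * real n powr (\<sigma> - 1) * ln 2"
      using assms by (simp add: divide_le_eq mult_ac)
    also have "\<dots> \<le> \<tau> * real n powr (\<sigma> - 1) * ln n"
      using n assms by (intro mult_left_mono) auto
    finally have "n * ln x \<le> n * (\<tau> * real n powr (\<sigma> - 1) * ln n)"
      by (intro mult_left_mono) auto
    also have "\<dots> = \<tau> * real n powr \<sigma> * ln n"
      using n by (simp add: powr_diff)
    finally have "ln (x ^ n / Mseq \<tau> \<sigma> n) \<le> 0"
      using n x by (simp add: Mseq_def ln_div ln_realpow ln_powr)
    also have "\<dots> \<le> max 1 K * ln x" using lx by simp
    finally show ?thesis .
  qed
  then show ?thesis by (intro bdd_aboveI[of _ "max 1 K * ln x"]) auto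
qed

lemma bdd_above_assoc_fun_sub:
  assumes "\<tau> > 0" "\<sigma> > 1" "x \<ge> 0"
  shows "bdd_above (range (\<lambda>n. ln (x ^ d n / Mseq \<tau> \<sigma> (d n))))"
  by (rule bdd_above_mono[OF bdd_above_assoc_fun[OF assms]]) auto

lemma assoc_fun_sub_eq_0:
  assumes "\<tau> > 0" "0 \<le> x" "x \<le> 1" "d 0 = 0"
  shows "assoc_fun_sub \<tau> \<sigma> d x = 0"
  unfolding assoc_fun_sub_def
proof (rule antisym)
  show "(SUP n. ln (x ^ d n / Mseq \<tau> \<sigma> (d n))) \<le> 0"
    using ln_term_nonpos[OF assms(1-3)] by (intro cSUP_least) auto
  have "ln (x ^ d 0 / Mseq \<tau> \<sigma> (d 0)) \<le> (SUP n. ln (x ^ d n / Mseq \<tau> \<sigma> (d n)))"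
    using ln_term_nonpos[OF assms(1-3)] by (intro cSUP_upper bdd_aboveI[of _ 0]) auto
  then show "0 \<le> (SUP n. ln (x ^ d n / Mseq \<tau> \<sigma> (d n)))"
    by (simp add: assms(4) Mseq_def)
qed

lemma assoc_fun_eq_0:
  assumes "\<tau> > 0" "0 \<le> x" "x \<le> 1"
  shows "assoc_fun \<tau> \<sigma> x = 0"
  using assoc_fun_sub_eq_0[OF assms, of "\<lambda>n. n"] by (simp add: assoc_fun_def assoc_fun_sub_def)

end

theory Submission
  imports Defs
begin

text \<open>
  For \<open>x \<ge> 1\<close>, bound the term with index \<open>n\<close> by the term whose index \<open>N = d m\<close> is the first one
  with \<open>n \<le> N\<close>. Then \<open>x ^ n \<le> x ^ N\<close>, so only the weights have to be compared.
  If \<open>m \<ge> 2\<close>, then \<open>N \<le> L n\<close> and \<open>n \<ge> 2\<close>, so \<open>N\<^sup>\<sigma> ln N\<close> is at most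
  \<open>L\<^sup>\<sigma> (1 + ln L / ln 2)\<close> times \<open>n\<^sup>\<sigma> ln n\<close>, and a small \<open>\<tau>1\<close> absorbs this factor.
  The ratio \<open>d 1 / d 0\<close> is not controlled, but for \<open>m = 1\<close> the weight
  \<open>\<tau>1 (d 1)\<^sup>\<sigma> ln (d 1)\<close> is at most \<open>1\<close> once \<open>\<tau>1\<close> is small depending on \<open>d 1\<close>.
  Hence even \<open>C1 = 1\<close> works.
\<close>

lemma Mseq_pos: "Mseq \<tau> \<sigma> n > 0"
  by (simp add: Mseq_def)

text \<open>At \<open>n = 0\<close> this uses the junk value \<open>ln 0 = 0\<close>.\<close>

lemma ln_Mseq: "ln (Mseq \<tau> \<sigma> n) = \<tau> * (real n powr \<sigma> * ln (real n))"
  by (simp add: Mseq_def ln_powr)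

lemma assoc_fun_sub_le_assoc_fun:
  assumes "\<tau> > 0" "\<sigma> > 1" "x \<ge> 0"
  shows "assoc_fun_sub \<tau> \<sigma> d x \<le> assoc_fun \<tau> \<sigma> x"
  unfolding assoc_fun_sub_def assoc_fun_def
  by (intro cSUP_least cSUP_upper[OF _ bdd_above_assoc_fun[OF assms]]) auto

text \<open>For \<open>x > 1\<close>, passing from \<open>n\<close> to a larger exponent
  \<open>d m\<close> only raises the power, so comparing the weights up to \<open>C\<close>
  suffices. On \<open>[0, 1]\<close> both functions vanish.\<close>

lemma assoc_fun_le_assoc_fun_sub:
  assumes "\<tau> > 0" "\<tau>1 > 0" "\<sigma> > 1" "C \<ge> 0" "x \<ge> 0" "d 0 = 0"
    and dominated: "\<And>n. \<exists>m. n \<le> d m \<and> ln (Mseq \<tau>1 \<sigma> (d m)) \<le> ln (Mseq \<tau> \<sigma> n) + C"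
  shows "assoc_fun \<tau> \<sigma> x \<le> assoc_fun_sub \<tau>1 \<sigma> d x + C"
proof (cases "x \<le> 1")
  case True
  then show ?thesis
    using assms by (simp add: assoc_fun_eq_0 assoc_fun_sub_eq_0)
next
  case False
  then have x: "x > 0" "ln x > 0" by auto
  have ln_term: "ln (x ^ k / Mseq t \<sigma> k) = real k * ln x - ln (Mseq t \<sigma> k)" for k t
    using x Mseq_pos[of t \<sigma> k] by (simp add: ln_div ln_realpow)
  show ?thesis
    unfolding assoc_fun_def
  proof (rule cSUP_least)
    fix n
    obtain m where m: "n \<le> d m" "ln (Mseq \<tau>1 \<sigma> (d m)) \<le> ln (Mseq \<tau> \<sigma> n) + C"
      using dominated by blast
    have "real n * ln x \<le> real (d m) * ln x"
      using m(1) x by (intro mult_right_mono) auto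
    with m(2) have "ln (x ^ n / Mseq \<tau> \<sigma> n) \<le> ln (x ^ d m / Mseq \<tau>1 \<sigma> (d m)) + C"
      by (simp only: ln_term)
    also have "ln (x ^ d m / Mseq \<tau>1 \<sigma> (d m)) \<le> assoc_fun_sub \<tau>1 \<sigma> d x"
      unfolding assoc_fun_sub_def
      using assms by (intro cSUP_upper bdd_above_assoc_fun_sub) auto
    finally show "ln (x ^ n / Mseq \<tau> \<sigma> n) \<le> assoc_fun_sub \<tau>1 \<sigma> d x + C" by simp
  qed auto
qed

text \<open>Since \<open>n \<ge> 2\<close>, the summand \<open>ln L\<close> in
  \<open>ln (L * n)\<close> is at most \<open>ln L / ln 2 * ln n\<close> and becomes part of a
  constant factor.\<close>

lemma powr_mult_ln_le:
  fixes \<sigma> L n N :: real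
  assumes "\<sigma> > 0" "L \<ge> 1" "n \<ge> 2" "N \<ge> 1" "N \<le> L * n"
  shows "N powr \<sigma> * ln N \<le> L powr \<sigma> * (1 + ln L / ln 2) * (n powr \<sigma> * ln n)"
proof -
  have "ln N \<le> ln (L * n)"
    using assms by (intro ln_mono) auto
  also have "\<dots> = ln L + ln n"
    using assms by (simp add: ln_mult)
  also have "\<dots> \<le> (1 + ln L / ln 2) * ln n"
  proof -
    have "ln L / ln 2 * ln 2 \<le> ln L / ln 2 * ln n"
      using assms by (intro mult_left_mono) auto
    then show ?thesis by (simp add: distrib_right)
  qed
  finally have ln_le: "ln N \<le> (1 + ln L / ln 2) * ln n" .
  have "N powr \<sigma> \<le> (L * n) powr \<sigma>"
    using assms by (intro powr_mono2) auto
  also have "\<dots> = L powr \<sigma> * n powr \<sigma>"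
    using assms by (simp add: powr_mult)
  finally have "N powr \<sigma> * ln N \<le> (L powr \<sigma> * n powr \<sigma>) * ((1 + ln L / ln 2) * ln n)"
    using ln_le assms by (intro mult_mono) auto
  then show ?thesis by (simp add: mult_ac)
qed

text \<open>For the least \<open>m\<close> with \<open>n \<le> d m\<close>, if
  \<open>m \<ge> 2\<close> then \<open>1 \<le> d (m - 1) < n\<close>, and the ratio bound applies at
  \<open>m - 1\<close>. For \<open>m = 1\<close> the preceding value is \<open>d 0 = 0\<close>,
  hence the separate alternative.\<close>

lemma exists_first_index_ge:
  fixes d :: "nat \<Rightarrow> nat"
  assumes "strict_mono d" "d 0 = 0" "\<And>k. k \<ge> 1 \<Longrightarrow> real (d (k + 1)) / real (d k) \<le> L"
    and "n > 0"
  obtains m where "n \<le> d m" "m = 1 \<or> n \<ge> 2 \<and> real (d m) \<le> L * real n"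
proof -
  define m where "m = (LEAST m. n \<le> d m)"
  have le: "n \<le> d m"
    \<comment> \<open>The index \<open>n\<close> itself is a witness, because
      \<open>n \<le> d n\<close>.\<close>
    unfolding m_def using strict_mono_imp_increasing[OF assms(1)] by (rule LeastI)
  have less: "d k < n" if "k < m" for k
    using not_less_Least[of k "\<lambda>m. n \<le> d m"] that by (simp add: m_def)
  have "m \<noteq> 0"
    using le assms(2,4) by (cases "m = 0") auto
  have "n \<ge> 2 \<and> real (d m) \<le> L * real n" if "m \<noteq> 1"
  proof -
    define k where "k = m - 1"
    have k: "k \<ge> 1" "m = k + 1"
      using \<open>m \<noteq> 0\<close> that by (auto simp: k_def)
    then have dk: "d k > 0" "d k < n"
      using strict_monoD[OF assms(1), of 0 k] assms(2) less by auto
    then have dm: "real (d m) \<le> L * real (d k)"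
      using assms(3)[OF k(1)] by (simp add: k(2) divide_le_eq)
    \<comment> \<open>The sign of \<open>L\<close> is read off from the ratio bound, as
      \<open>d m\<close> is nonnegative.\<close>
    have "L * real (d k) \<ge> 0"
      using dm by (rule order_trans[rotated]) simp
    then have "L \<ge> 0"
      using dk by (simp add: zero_le_mult_iff)
    then have "L * real (d k) \<le> L * real n"
      using dk by (intro mult_left_mono) auto
    with dm dk show ?thesis by linarith
  qed
  with le show thesis by (intro that) auto
qed

theorem lemma4p5:
  fixes \<sigma> \<tau> L :: real
  assumes "\<sigma> > 1" and "\<tau> > 0" and "L > 1"
  shows "\<exists>C1>0. \<forall>d :: nat \<Rightarrow> nat.
    strict_mono d \<longrightarrow> filterlim d at_top sequentially \<longrightarrow> d 0 = 0 \<longrightarrow>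
    (\<forall>n\<ge>1. real (d (n + 1)) / real (d n) \<le> L) \<longrightarrow>
    (\<exists>\<tau>1>0. \<forall>x\<ge>0. assoc_fun_sub \<tau> \<sigma> d x \<le> assoc_fun \<tau> \<sigma> x \<and>
                    assoc_fun \<tau> \<sigma> x \<le> assoc_fun_sub \<tau>1 \<sigma> d x + C1)"
proof (rule exI[of _ 1], intro conjI allI impI)
  fix d :: "nat \<Rightarrow> nat"
  assume mono: "strict_mono d" and d0: "d 0 = 0"
    and ratio: "\<forall>n\<ge>1. real (d (n + 1)) / real (d n) \<le> L"
  define w where "w N = real N powr \<sigma> * ln (real N)" for N
  define A where "A = L powr \<sigma> * (1 + ln L / ln 2)"
  \<comment> \<open>The first entry serves \<open>m \<ge> 2\<close>, the second
    \<open>m = 1\<close>; the summand 1 keeps the denominator positive when \<open>d 1 = 1\<close>,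
    where \<open>w (d 1) = 0\<close>.\<close>
  define \<tau>1 where "\<tau>1 = min (\<tau> / A) (1 / (1 + w (d 1)))"
  have w_nonneg: "w N \<ge> 0" for N
    by (cases "N = 0") (auto simp: w_def)
  have "A > 0"
    using assms by (auto simp: A_def intro!: mult_pos_pos add_pos_nonneg)
  have "\<tau>1 > 0"
    using \<open>A > 0\<close> assms w_nonneg[of "d 1"] by (simp add: \<tau>1_def)
  have "\<exists>m. n \<le> d m \<and> ln (Mseq \<tau>1 \<sigma> (d m)) \<le> ln (Mseq \<tau> \<sigma> n) + 1" for n
  proof (cases "n = 0")
    case True
    then show ?thesis using d0 by (intro exI[of _ 0]) (simp add: ln_Mseq)
  next
    case False
    then obtain m where m: "n \<le> d m" "m = 1 \<or> n \<ge> 2 \<and> real (d m) \<le> L * real n"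
      using exists_first_index_ge[OF mono d0] ratio by (metis gr0I)
    have "\<tau>1 * w (d m) \<le> \<tau> * w n + 1"
      using m(2)
    proof
      assume "m = 1"
      have "\<tau>1 * w (d 1) \<le> 1 / (1 + w (d 1)) * w (d 1)"
        using w_nonneg by (intro mult_right_mono) (auto simp: \<tau>1_def)
      also have "\<dots> \<le> 1"
        using w_nonneg[of "d 1"] by (simp add: divide_le_eq)
      also have "\<dots> \<le> \<tau> * w n + 1"
        using w_nonneg assms by simp
      finally show ?thesis using \<open>m = 1\<close> by simp
    next
      assume n: "n \<ge> 2 \<and> real (d m) \<le> L * real n"
      then have "w (d m) \<le> A * w n"
        unfolding w_def A_def using m(1) assms by (intro powr_mult_ln_le) auto
      then have "\<tau>1 * w (d m) \<le> \<tau> / A * (A * w n)"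
        using w_nonneg \<open>A > 0\<close> assms by (intro mult_mono) (auto simp: \<tau>1_def)
      also have "\<dots> = \<tau> * w n"
        using \<open>A > 0\<close> by simp
      finally show ?thesis by simp
    qed
    with m(1) show ?thesis by (auto simp: ln_Mseq w_def)
  qed
  then show "\<exists>\<tau>1>0. \<forall>x\<ge>0. assoc_fun_sub \<tau> \<sigma> d x \<le> assoc_fun \<tau> \<sigma> x \<and>
                    assoc_fun \<tau> \<sigma> x \<le> assoc_fun_sub \<tau>1 \<sigma> d x + 1"
    using assms d0 \<open>\<tau>1 > 0\<close>
    by (intro exI[of _ \<tau>1] conjI allI impI assoc_fun_sub_le_assoc_fun assoc_fun_le_assoc_fun_sub)
      auto
qed simp

end
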